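(* Let $(x_1,\dots,x_p,y_1,\dots,y_p)$ be coordinates on $\mathbb{R}^{2p}$. Let $\psi_{ij}(x)=\psi_{ji}(x)$, $1\le i,j\le p$, be given smooth functions of $x=(x_1,\dots,x_p)$. Let $\mathcal{M}=(\mathbb{R}^{2p},g)$ be the pseudo-Riemannian manifold of neutral signature $(p,p)$ whose metric has the (possibly) non-zero components $$g(\partial_{x_i},\partial_{x_j})=\psi_{ij}(x)\quad\text{and}\quad g(\partial_{x_i},\partial_{y_i})=g(\partial_{y_i},\partial_{x_i})=1,$$ all other components with respect to the coordinate frame being zero. Then $\mathcal{M}$ is skew Tsankov and $\mathcal{R}$ is nilpotent of order $2$.
   Context: For a pseudo-Riemannian manifold $\mathcal{M}=(M,g)$, let $R$ be the curvature tensor of the Levi-Civita connection and let $\mathcal{R}(x,y)$ be the skew-symmetric curvature operator, $g(\mathcal{R}(x,y)z,w)=R(x,y,z,w)$. $\mathcal{M}$ is skew Tsankov if for every $P\in M$, $\mathcal{R}(x_1,x_2)\mathcal{R}(x_3,x_4)=\mathcal{R}(x_3,x_4)\mathcal{R}(x_1,x_2)$ for all $x_1,x_2,x_3,x_4\in T_PM$. "$\mathcal{R}$ is nilpotent of order $k$" means that $\mathcal{R}(\xi_1,\xi_2)^k=0$ for every $P\in M$ and all $\xi_1,\xi_2\in T_PM$ (no claim is made that $k$ is minimal; e.g. the flat case $\mathcal{R}=0$ is included). *)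

theory Defs
  imports "HOL-Analysis.Analysis"
begin

section \<open>Smooth functions on a Euclidean space\<close>

fun k_times_cont_diff ::
  "nat \<Rightarrow> ('a::euclidean_space \<Rightarrow> 'b::real_normed_vector) \<Rightarrow> bool" where
  "k_times_cont_diff 0 f \<longleftrightarrow> continuous_on UNIV f"
| "k_times_cont_diff (Suc k) f \<longleftrightarrow>
     (\<forall>P. f differentiable (at P)) \<and>
     (\<forall>v. k_times_cont_diff k (\<lambda>P. frechet_derivative f (at P) v))"

definition smooth :: "('a::euclidean_space \<Rightarrow> 'b::real_normed_vector) \<Rightarrow> bool" where
  "smooth f \<longleftrightarrow> (\<forall>k. k_times_cont_diff k f)"


section \<open>Pseudo-Riemannian geometry of a Euclidean space with its global chart\<close>

text \<open>
  The underlying manifold is the whole space \<^typ>\<open>'a::euclidean_space\<close>. Every tangent space is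
  identified with the space itself by the global chart, so a vector field is a map from the
  space to itself and a metric is a map \<open>g\<close> with \<open>g P v w\<close> the inner product of the tangent
  vectors \<open>v\<close> and \<open>w\<close> at the point \<open>P\<close>.
\<close>

type_synonym 'a vfield = "'a \<Rightarrow> 'a"
type_synonym 'a metric = "'a \<Rightarrow> 'a \<Rightarrow> 'a \<Rightarrow> real"
type_synonym 'a connection = "'a vfield \<Rightarrow> 'a vfield \<Rightarrow> 'a vfield"

definition pseudo_riemannian_metric :: "'a::euclidean_space metric \<Rightarrow> bool" where
  "pseudo_riemannian_metric g \<longleftrightarrow>
     (\<forall>v w. smooth (\<lambda>P. g P v w)) \<and>
     (\<forall>P. bilinear (g P)) \<and>
     (\<forall>P v w. g P v w = g P w v) \<and>
     (\<forall>P v. (\<forall>w. g P v w = 0) \<longrightarrow> v = 0)"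

text \<open>Signature \<open>(r, s)\<close>: an orthonormal basis has \<open>r\<close> timelike and \<open>s\<close> spacelike vectors.\<close>

definition has_signature ::
  "('a::euclidean_space \<Rightarrow> 'a \<Rightarrow> real) \<Rightarrow> nat \<Rightarrow> nat \<Rightarrow> bool" where
  "has_signature b r s \<longleftrightarrow>
     (\<exists>B. independent B \<and> span B = UNIV \<and>
          (\<forall>u\<in>B. \<forall>v\<in>B. u \<noteq> v \<longrightarrow> b u v = 0) \<and>
          (\<forall>v\<in>B. b v v = -1 \<or> b v v = 1) \<and>
          card {v\<in>B. b v v = -1} = r \<and>
          card {v\<in>B. b v v = 1} = s)"

text \<open>
  The derivative along \<open>X\<close> of a function. On vector fields it differentiates the components in
  the global chart, so that \<open>[X, Y]\<close> is \<open>X Y\<^sup>a - Y X\<^sup>a\<close> in components.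
\<close>

definition deriv_along ::
  "'a::euclidean_space vfield \<Rightarrow> ('a \<Rightarrow> 'b::real_normed_vector) \<Rightarrow> 'a \<Rightarrow> 'b" where
  "deriv_along X f = (\<lambda>P. frechet_derivative f (at P) (X P))"

definition lie_bracket :: "'a::euclidean_space vfield \<Rightarrow> 'a vfield \<Rightarrow> 'a vfield" where
  "lie_bracket X Y = (\<lambda>P. deriv_along X Y P - deriv_along Y X P)"

text \<open>
  A connection acts on smooth vector fields. The last clause extends it by zero to all other
  arguments; it only serves to make a connection unique as a HOL function.
\<close>

definition affine_connection :: "'a::euclidean_space connection \<Rightarrow> bool" where
  "affine_connection D \<longleftrightarrow>
     (\<forall>X Y. smooth X \<and> smooth Y \<longrightarrow> smooth (D X Y)) \<and>
     (\<forall>X X' Y. smooth X \<and> smooth X' \<and> smooth Y \<longrightarrow>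
        D (\<lambda>P. X P + X' P) Y = (\<lambda>P. D X Y P + D X' Y P)) \<and>
     (\<forall>X Y f. smooth X \<and> smooth Y \<and> smooth f \<longrightarrow>
        D (\<lambda>P. f P *\<^sub>R X P) Y = (\<lambda>P. f P *\<^sub>R D X Y P)) \<and>
     (\<forall>X Y Y'. smooth X \<and> smooth Y \<and> smooth Y' \<longrightarrow>
        D X (\<lambda>P. Y P + Y' P) = (\<lambda>P. D X Y P + D X Y' P)) \<and>
     (\<forall>X Y f. smooth X \<and> smooth Y \<and> smooth f \<longrightarrow>
        D X (\<lambda>P. f P *\<^sub>R Y P) =
          (\<lambda>P. deriv_along X f P *\<^sub>R Y P + f P *\<^sub>R D X Y P)) \<and>
     (\<forall>X Y. \<not> (smooth X \<and> smooth Y) \<longrightarrow> D X Y = (\<lambda>P. 0))"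

definition torsion_free :: "'a::euclidean_space connection \<Rightarrow> bool" where
  "torsion_free D \<longleftrightarrow>
     (\<forall>X Y. smooth X \<and> smooth Y \<longrightarrow>
        (\<lambda>P. D X Y P - D Y X P) = lie_bracket X Y)"

definition metric_connection :: "'a::euclidean_space metric \<Rightarrow> 'a connection \<Rightarrow> bool" where
  "metric_connection g D \<longleftrightarrow>
     (\<forall>X Y Z. smooth X \<and> smooth Y \<and> smooth Z \<longrightarrow>
        deriv_along X (\<lambda>P. g P (Y P) (Z P)) =
          (\<lambda>P. g P (D X Y P) (Z P) + g P (Y P) (D X Z P)))"

definition levi_civita :: "'a::euclidean_space metric \<Rightarrow> 'a connection" where
  "levi_civita g =
     (THE D. affine_connection D \<and> torsion_free D \<and> metric_connection g D)"

definition curvature ::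
  "'a::euclidean_space connection \<Rightarrow> 'a vfield \<Rightarrow> 'a vfield \<Rightarrow> 'a vfield \<Rightarrow> 'a vfield" where
  "curvature D X Y Z =
     (\<lambda>P. D X (D Y Z) P - D Y (D X Z) P - D (lie_bracket X Y) Z P)"

text \<open>
  The skew-symmetric curvature operator at \<open>P\<close>. Curvature is tensorial, so its value at \<open>P\<close>
  depends only on the tangent vectors at \<open>P\<close>; they are extended to vector fields with constant
  components in the global chart.
\<close>

definition curvature_operator ::
  "'a::euclidean_space metric \<Rightarrow> 'a \<Rightarrow> 'a \<Rightarrow> 'a \<Rightarrow> 'a \<Rightarrow> 'a" where
  "curvature_operator g P x y =
     (\<lambda>z. curvature (levi_civita g) (\<lambda>Q. x) (\<lambda>Q. y) (\<lambda>Q. z) P)"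

definition skew_tsankov :: "'a::euclidean_space metric \<Rightarrow> bool" where
  "skew_tsankov g \<longleftrightarrow>
     (\<forall>P x1 x2 x3 x4.
        curvature_operator g P x1 x2 \<circ> curvature_operator g P x3 x4 =
        curvature_operator g P x3 x4 \<circ> curvature_operator g P x1 x2)"

definition curvature_nilpotent :: "'a::euclidean_space metric \<Rightarrow> nat \<Rightarrow> bool" where
  "curvature_nilpotent g k \<longleftrightarrow> (\<forall>P x y. (curvature_operator g P x y ^^ k) = (\<lambda>z. 0))"


section \<open>The metric on \<open>\<real>\<^sup>2\<^sup>p\<close>\<close>

text \<open>
  The coordinates \<open>(x\<^sub>1, \<dots>, x\<^sub>p, y\<^sub>1, \<dots>, y\<^sub>p)\<close> are indexed by the sum type \<^typ>\<open>'p + 'p\<close>, where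
  \<open>p\<close> is the cardinality of \<^typ>\<open>'p\<close>: \<open>Inl i\<close> stands for \<open>x\<^sub>i\<close> and \<open>Inr i\<close> for \<open>y\<^sub>i\<close>. The
  coordinate vector fields are the constant fields \<open>axis (Inl i) 1\<close> and \<open>axis (Inr i) 1\<close>.
\<close>

definition x_part :: "real ^ ('p::finite + 'p) \<Rightarrow> real ^ 'p" where
  "x_part P = (\<chi> i. P $ Inl i)"

fun g_psi_component ::
  "('p::finite \<Rightarrow> 'p \<Rightarrow> real ^ 'p \<Rightarrow> real) \<Rightarrow> real ^ ('p + 'p) \<Rightarrow> 'p + 'p \<Rightarrow> 'p + 'p \<Rightarrow> real" where
  "g_psi_component \<psi> P (Inl i) (Inl j) = \<psi> i j (x_part P)"
| "g_psi_component \<psi> P (Inl i) (Inr j) = (if i = j then 1 else 0)"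
| "g_psi_component \<psi> P (Inr i) (Inl j) = (if i = j then 1 else 0)"
| "g_psi_component \<psi> P (Inr i) (Inr j) = 0"

definition g_psi ::
  "('p::finite \<Rightarrow> 'p \<Rightarrow> real ^ 'p \<Rightarrow> real) \<Rightarrow> (real ^ ('p + 'p)) metric" where
  "g_psi \<psi> P v w = (\<Sum>a\<in>UNIV. \<Sum>b\<in>UNIV. g_psi_component \<psi> P a b * v $ a * w $ b)"

lemma g_psi_axis: "g_psi \<psi> P (axis a 1) (axis b 1) = g_psi_component \<psi> P a b"
proof -
  have "g_psi \<psi> P (axis a 1) (axis b 1) =
      (\<Sum>c\<in>UNIV. \<Sum>d\<in>UNIV. if d = b then (if c = a then g_psi_component \<psi> P c d else 0) else 0)"
    unfolding g_psi_def by (intro sum.cong) (auto simp: axis_def)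
  also have "\<dots> = g_psi_component \<psi> P a b"
    by (simp only: sum.delta[OF finite_class.finite_UNIV] UNIV_I if_True)
  finally show ?thesis .
qed

end

theory Submission
  imports Defs
begin

text \<open>
  Call a tangent vector vertical if its \<open>x\<close>-part vanishes. Every derivative of the coefficients of
  the metric comes from the \<open>\<psi>\<^sub>i\<^sub>j\<close>, which depend on \<open>x\<close> alone and only pair \<open>x\<close>-components; so
  the derivative of \<open>g(v, w)\<close> along \<open>u\<close>, for constant \<open>u\<close>, \<open>v\<close>, \<open>w\<close>, vanishes as soon as one of
  the three is vertical. Put into the Koszul formula, this says two things about the Christoffel
  map \<open>\<Gamma>\<close>. Firstly \<open>g(\<Gamma>(u, v), w) = 0\<close> for vertical \<open>w\<close>, and because the vertical space is its own
  orthogonal complement, \<open>\<Gamma>\<close> takes vertical values. Secondly \<open>\<Gamma>(u, v) = 0\<close> for vertical \<open>v\<close>.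
  On constant fields the curvature is \<open>R(x, y) z = \<partial>\<^sub>x \<Gamma>(y, z) + \<Gamma>(x, \<Gamma>(y, z))\<close> minus the same with
  \<open>x\<close> and \<open>y\<close> exchanged, so it inherits both properties: it maps everything to vertical vectors and
  kills vertical vectors (\<open>curvature_vertical\<close>). Hence the product of any two curvature operators is
  zero (\<open>curvature_operator_comp\<close>), from which both the commutation and \<open>\<R>(x, y)\<^sup>2 = 0\<close> are
  immediate.

  Since the Levi-Civita connection is given by a definite description, it must be identified first:
  a metric torsion-free connection is unique (\<open>metric_torsion_free_connection_unique\<close>), and
  \<open>\<partial>\<^sub>X Y + \<Gamma>(X, Y)\<close> is one (\<open>levi_civita_eq_christoffel_connection\<close>). The smoothness calculus serves
  this step.

  The signature is \<open>(p, p)\<close> because correcting \<open>\<partial>\<^sub>x\<^sub>i\<close> by a vertical vector yields null vectors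
  \<open>u\<^sub>i = \<partial>\<^sub>x\<^sub>i - 1/2 \<Sum>\<^sub>j \<psi>\<^sub>i\<^sub>j \<partial>\<^sub>y\<^sub>j\<close> with \<open>g(u\<^sub>i, u\<^sub>j) = 0\<close> and \<open>g(u\<^sub>i, \<partial>\<^sub>y\<^sub>j) = \<delta>\<^sub>i\<^sub>j\<close>, so that
  the vectors \<open>u\<^sub>i \<plusminus> 1/2 \<partial>\<^sub>y\<^sub>i\<close> are orthonormal with signs \<open>\<plusminus>\<close> (\<open>has_signature_g_psi\<close>).
\<close>


section \<open>Calculus of smooth functions\<close>

lemma smooth_differentiable: "smooth f \<Longrightarrow> f differentiable (at P)"
  unfolding smooth_def by (metis k_times_cont_diff.simps(2))

lemma smooth_has_derivative: "smooth f \<Longrightarrow> (f has_derivative frechet_derivative f (at P)) (at P)"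
  using smooth_differentiable frechet_derivative_works by blast

lemma smooth_continuous_on: "smooth f \<Longrightarrow> continuous_on UNIV f"
  unfolding smooth_def by (metis k_times_cont_diff.simps(1))

lemma smooth_directional_derivative:
  "smooth f \<Longrightarrow> smooth (\<lambda>P. frechet_derivative f (at P) v)"
  unfolding smooth_def by (metis k_times_cont_diff.simps(2))

lemma smooth_const [simp]:
  fixes c :: "'b::real_normed_vector"
  shows "smooth (\<lambda>P::'a::euclidean_space. c)"
proof -
  have "k_times_cont_diff k (\<lambda>P::'a. c)" for k
    by (induction k arbitrary: c) (auto simp: frechet_derivative_const)
  then show ?thesis
    by (simp add: smooth_def)
qed

lemma k_times_cont_diff_add:
  assumes "k_times_cont_diff k f" "k_times_cont_diff k g"
  shows "k_times_cont_diff k (\<lambda>P. f P + g P)"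
  using assms
proof (induction k arbitrary: f g)
  case 0
  then show ?case
    by (auto intro: continuous_on_add)
next
  case (Suc k)
  have "frechet_derivative (\<lambda>P. f P + g P) (at P) =
      (\<lambda>v. frechet_derivative f (at P) v + frechet_derivative g (at P) v)" for P
    using Suc.prems
    by (intro frechet_derivative_at[symmetric] has_derivative_add)
      (auto simp: frechet_derivative_works)
  then show ?case
    using Suc by auto
qed

lemma smooth_add: "smooth f \<Longrightarrow> smooth g \<Longrightarrow> smooth (\<lambda>P. f P + g P)"
  by (simp add: smooth_def k_times_cont_diff_add)

lemma smooth_sum:
  "(\<And>i. i \<in> I \<Longrightarrow> smooth (f i)) \<Longrightarrow> smooth (\<lambda>P. \<Sum>i\<in>I. f i P)"
  by (induction I rule: infinite_finite_induct) (auto intro: smooth_add)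

text \<open>
  By the product rule each directional derivative is a sum of two products of smooth functions, so
  the induction over the order of differentiation has to range over all smooth factors.
\<close>

lemma smooth_bounded_bilinear:
  fixes h :: "'b::real_normed_vector \<Rightarrow> 'c::real_normed_vector \<Rightarrow> 'd::real_normed_vector"
    and f :: "'a::euclidean_space \<Rightarrow> 'b" and g :: "'a \<Rightarrow> 'c"
  assumes h: "bounded_bilinear h" and "smooth f" "smooth g"
  shows "smooth (\<lambda>P. h (f P) (g P))"
proof -
  have "k_times_cont_diff k (\<lambda>P. h (f P) (g P))" for k
    using assms(2,3)
  proof (induction k arbitrary: f g)
    case 0
    then show ?case
      by (simp add: bounded_bilinear.continuous_on[OF h] smooth_continuous_on)
  next
    case (Suc k)
    note der = bounded_bilinear.FDERIV[OF h smooth_has_derivative[OF Suc.prems(1)]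
        smooth_has_derivative[OF Suc.prems(2)]]
    have D: "frechet_derivative (\<lambda>P. h (f P) (g P)) (at P) =
        (\<lambda>v. h (f P) (frechet_derivative g (at P) v) + h (frechet_derivative f (at P) v) (g P))" for P
      using frechet_derivative_at[OF der] by simp
    show ?case
      using der by (auto simp: D differentiable_def
          intro!: k_times_cont_diff_add Suc.IH Suc.prems smooth_directional_derivative)
  qed
  then show ?thesis
    by (simp add: smooth_def)
qed

lemmas smooth_scaleR = smooth_bounded_bilinear[OF bounded_bilinear_scaleR]
lemmas smooth_mult = smooth_bounded_bilinear[OF bounded_bilinear_mult]
lemmas smooth_inner = smooth_bounded_bilinear[OF bounded_bilinear_inner]

lemma smooth_minus:
  assumes "smooth f" "smooth g"
  shows "smooth (\<lambda>P. f P - g P)"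
  using smooth_add[OF assms(1) smooth_scaleR[OF smooth_const[of "-1"] assms(2)]] by simp

lemma frechet_derivative_compose_linear:
  assumes "bounded_linear L" "f differentiable (at (L P))"
  shows "((\<lambda>Q. f (L Q)) has_derivative (\<lambda>v. frechet_derivative f (at (L P)) (L v))) (at P)"
  using has_derivative_compose[OF bounded_linear_imp_has_derivative[OF assms(1)], of f _ P UNIV] assms(2)
  by (auto simp: frechet_derivative_works)

lemma smooth_compose_linear:
  fixes L :: "'a::euclidean_space \<Rightarrow> 'b::euclidean_space" and f :: "'b \<Rightarrow> 'c::real_normed_vector"
  assumes L: "bounded_linear L" and "smooth f"
  shows "smooth (\<lambda>P. f (L P))"
proof -
  have "k_times_cont_diff k (\<lambda>P. f (L P))" for k
    using assms(2)
  proof (induction k arbitrary: f)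
    case 0
    then show ?case
      using frechet_derivative_compose_linear[OF L smooth_differentiable[OF 0]]
      by (auto intro!: continuous_at_imp_continuous_on has_derivative_continuous)
  next
    case (Suc k)
    note der = frechet_derivative_compose_linear[OF L smooth_differentiable[OF Suc.prems]]
    show ?case
      using der Suc.IH[OF smooth_directional_derivative[OF Suc.prems]]
      by (auto simp: frechet_derivative_at[OF der, symmetric] differentiable_def)
  qed
  then show ?thesis
    by (simp add: smooth_def)
qed

text \<open>
  Expanding \<open>X\<close> in a fixed basis reduces this to derivatives of \<open>f\<close> in constant directions, the only
  ones that the definition of smoothness speaks of.
\<close>

lemma smooth_deriv_along:
  assumes "smooth X" "smooth f"
  shows "smooth (deriv_along X f)"
proof -
  have "frechet_derivative f (at P) (X P) =
      (\<Sum>b\<in>Basis. (X P \<bullet> b) *\<^sub>R frechet_derivative f (at P) b)" for P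
  proof -
    interpret linear "frechet_derivative f (at P)"
      by (rule linear_frechet_derivative[OF smooth_differentiable[OF assms(2)]])
    show ?thesis
      by (subst euclidean_representation[of "X P", symmetric]) (simp only: sum scale)
  qed
  then show ?thesis
    unfolding deriv_along_def using assms
    by (auto intro!: smooth_sum smooth_scaleR smooth_inner smooth_directional_derivative)
qed


section \<open>Fields of bilinear maps\<close>

text \<open>
  This expansion turns a field of bilinear maps with smooth values on constant vectors into a sum of
  products of smooth functions, so that the product rule applies.
\<close>

lemma bilinear_basis_expansion:
  fixes h :: "'a::euclidean_space \<Rightarrow> 'b::euclidean_space \<Rightarrow> 'c::real_vector"
  assumes "bilinear h"
  shows "h v w = (\<Sum>a\<in>Basis. \<Sum>b\<in>Basis. ((v \<bullet> a) * (w \<bullet> b)) *\<^sub>R h a b)"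
proof -
  have l: "linear (\<lambda>v. h v w)" and r: "linear (h v)" for v w
    using assms by (simp_all add: bilinear_def)
  have "h v w = (\<Sum>a\<in>Basis. (v \<bullet> a) *\<^sub>R h a w)"
    using linear_sum[OF l, of "\<lambda>a. (v \<bullet> a) *\<^sub>R a" Basis w]
    by (simp add: euclidean_representation linear_scale[OF l])
  also have "\<dots> = (\<Sum>a\<in>Basis. \<Sum>b\<in>Basis. ((v \<bullet> a) * (w \<bullet> b)) *\<^sub>R h a b)"
  proof (rule sum.cong[OF refl])
    fix a :: 'a
    have "h a w = (\<Sum>b\<in>Basis. (w \<bullet> b) *\<^sub>R h a b)"
      using linear_sum[OF r, of a "\<lambda>b. (w \<bullet> b) *\<^sub>R b" Basis]
      by (simp add: euclidean_representation linear_scale[OF r])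
    then show "(v \<bullet> a) *\<^sub>R h a w = (\<Sum>b\<in>Basis. ((v \<bullet> a) * (w \<bullet> b)) *\<^sub>R h a b)"
      by (simp add: scaleR_sum_right)
  qed
  finally show ?thesis .
qed

lemma smooth_bilinear_field:
  fixes Y :: "'a::euclidean_space \<Rightarrow> 'b::euclidean_space" and Z :: "'a \<Rightarrow> 'c::euclidean_space"
    and B :: "'a \<Rightarrow> 'b \<Rightarrow> 'c \<Rightarrow> 'd::real_normed_vector"
  assumes "\<And>P. bilinear (B P)" "\<And>v w. smooth (\<lambda>P. B P v w)" "smooth Y" "smooth Z"
  shows "smooth (\<lambda>P. B P (Y P) (Z P))"
  by (subst bilinear_basis_expansion[OF assms(1)])
    (intro smooth_sum smooth_scaleR smooth_mult smooth_inner smooth_const assms)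

lemma bilinear_derivative:
  fixes B :: "'a::euclidean_space \<Rightarrow> 'b::euclidean_space \<Rightarrow> 'c::euclidean_space \<Rightarrow> 'd::real_normed_vector"
  assumes B: "\<And>P. bilinear (B P)" and d: "\<And>v w. (\<lambda>Q. B Q v w) differentiable (at P)"
  shows "bilinear (\<lambda>v w. frechet_derivative (\<lambda>Q. B Q v w) (at P) u)"
proof -
  have eq: "frechet_derivative f (at P) u = f' u" if "(f has_derivative f') (at P)" for f f'
    using frechet_derivative_at[OF that] by simp
  note der = d[unfolded frechet_derivative_works]
  show ?thesis
    unfolding bilinear_def linear_iff
    by (intro conjI allI; rule eq)
      (simp_all only: bilinear_ladd[OF B] bilinear_radd[OF B] bilinear_lmul[OF B] bilinear_rmul[OF B]
        has_derivative_add[OF der der] has_derivative_scaleR_right[OF der])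
qed

text \<open>
  The value varies with the base point and with each of the two arguments, which gives the three
  terms of the derivative. Applied to \<open>g(Y, Z)\<close>, it reduces metric compatibility of a connection
  to an identity for constant vectors.
\<close>

lemma has_derivative_bilinear_field:
  fixes Y :: "'a::euclidean_space \<Rightarrow> 'b::euclidean_space" and Z :: "'a \<Rightarrow> 'c::euclidean_space"
    and B :: "'a \<Rightarrow> 'b \<Rightarrow> 'c \<Rightarrow> 'd::real_normed_vector"
  assumes B: "\<And>P. bilinear (B P)" and d: "\<And>v w. (\<lambda>Q. B Q v w) differentiable (at P)"
    and Y: "(Y has_derivative Y') (at P)" and Z: "(Z has_derivative Z') (at P)"
  shows "((\<lambda>Q. B Q (Y Q) (Z Q)) has_derivative
    (\<lambda>u. frechet_derivative (\<lambda>Q. B Q (Y P) (Z P)) (at P) u + B P (Y' u) (Z P) + B P (Y P) (Z' u))) (at P)"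
proof -
  note [derivative_intros] = d[unfolded frechet_derivative_works]
  have "((\<lambda>Q. B Q (Y Q) (Z Q)) has_derivative
    (\<lambda>u. (\<Sum>a\<in>Basis. \<Sum>b\<in>Basis. ((Y P \<bullet> a) * (Z P \<bullet> b)) *\<^sub>R frechet_derivative (\<lambda>Q. B Q a b) (at P) u)
      + (\<Sum>a\<in>Basis. \<Sum>b\<in>Basis. ((Y' u \<bullet> a) * (Z P \<bullet> b)) *\<^sub>R B P a b)
      + (\<Sum>a\<in>Basis. \<Sum>b\<in>Basis. ((Y P \<bullet> a) * (Z' u \<bullet> b)) *\<^sub>R B P a b))) (at P)"
    by (subst bilinear_basis_expansion[OF B], (rule derivative_eq_intros Y Z refl)+)
      (simp add: sum.distrib algebra_simps)
  then show ?thesis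
    by (simp only: bilinear_basis_expansion[OF bilinear_derivative[where B = B, OF B d], symmetric]
        bilinear_basis_expansion[OF B, symmetric])
qed


section \<open>Connections\<close>

text \<open>
  The difference \<open>S\<close> of two such connections is symmetric by torsion-freeness, and \<open>g(S(X, Y), Z)\<close>
  is skew in \<open>Y\<close> and \<open>Z\<close> by metric compatibility. A form of three arguments that is symmetric in the
  first two and skew in the last two is zero: six alternating exchanges return to the start with
  the opposite sign. Equality on smooth fields suffices, as an affine connection is zero elsewhere.
\<close>

lemma metric_torsion_free_connection_unique:
  assumes g: "pseudo_riemannian_metric g"
    and D: "affine_connection D" "torsion_free D" "metric_connection g D"
    and E: "affine_connection E" "torsion_free E" "metric_connection g E"
  shows "D = E"
proof -
  have bil: "\<And>P. bilinear (g P)" and sym: "\<And>P v w. g P v w = g P w v"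
    and nondeg: "\<And>P v. (\<And>w. g P v w = 0) \<Longrightarrow> v = 0"
    using g unfolding pseudo_riemannian_metric_def by blast+
  have "D X Y P = E X Y P" if X: "smooth X" and Y: "smooth Y" for X Y P
  proof -
    define S where "S X Y = D X Y P - E X Y P" for X Y
    have S_sym: "S X Y = S Y X" if "smooth X" "smooth Y" for X Y
    proof -
      have "D X Y P - D Y X P = E X Y P - E Y X P"
        using fun_cong[of _ _ P, OF D(2)[unfolded torsion_free_def, rule_format, of X Y]]
          fun_cong[of _ _ P, OF E(2)[unfolded torsion_free_def, rule_format, of X Y]] that by simp
      then show ?thesis
        by (simp add: S_def algebra_simps)
    qed
    have S_skew: "g P (S X Y) (Z P) = - g P (S X Z) (Y P)"
      if "smooth X" "smooth Y" "smooth Z" for X Y Z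
    proof -
      have "g P (D X Y P) (Z P) + g P (Y P) (D X Z P) = g P (E X Y P) (Z P) + g P (Y P) (E X Z P)"
        using fun_cong[of _ _ P, OF D(3)[unfolded metric_connection_def, rule_format, of X Y Z]]
          fun_cong[of _ _ P, OF E(3)[unfolded metric_connection_def, rule_format, of X Y Z]] that by simp
      then show ?thesis
        by (simp add: S_def bilinear_lsub[OF bil] sym[of P "Y P"])
    qed
    have "g P (S X Y) z = 0" for z
    proof -
      \<comment> \<open>Non-degeneracy at \<open>P\<close> asks for all tangent vectors \<open>z\<close>; the skew symmetry needs a field through \<open>z\<close>.\<close>
      define Z :: "'a \<Rightarrow> 'a" where "Z = (\<lambda>Q. z)"
      have Z: "smooth Z"
        by (simp add: Z_def)
      have "g P (S X Y) (Z P) = - g P (S X Y) (Z P)"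
        using S_sym[OF X Y] S_sym[OF Y Z] S_sym[OF X Z]
          S_skew[OF X Y Z] S_skew[OF Z X Y] S_skew[OF Y Z X] by (simp add: S_sym)
      then show ?thesis
        by (simp add: Z_def)
    qed
    then have "S X Y = 0"
      by (rule nondeg)
    then show ?thesis
      by (simp add: S_def)
  qed
  moreover have "D X Y P = E X Y P" if "\<not> (smooth X \<and> smooth Y)" for X Y P
    using D(1) E(1) that by (simp add: affine_connection_def)
  ultimately show ?thesis
    by blast
qed

text \<open>
  The value zero on other arguments than smooth fields is the one that \<^const>\<open>affine_connection\<close>
  prescribes.
\<close>

definition christoffel_connection ::
  "('a \<Rightarrow> 'a \<Rightarrow> 'a \<Rightarrow> 'a) \<Rightarrow> 'a::euclidean_space connection" where
  "christoffel_connection \<Gamma> X Y =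
    (if smooth X \<and> smooth Y then (\<lambda>P. deriv_along X Y P + \<Gamma> P (X P) (Y P)) else (\<lambda>P. 0))"

lemma affine_christoffel_connection:
  assumes bil: "\<And>P. bilinear (\<Gamma> P)" and sm: "\<And>v w. smooth (\<lambda>P. \<Gamma> P v w)"
  shows "affine_connection (christoffel_connection \<Gamma>)"
proof -
  have lin: "linear (frechet_derivative Y (at P))" if "smooth Y" for Y :: "'a vfield" and P
    by (rule linear_frechet_derivative[OF smooth_differentiable[OF that]])
  have add: "deriv_along X (\<lambda>P. Y P + Y' P) P = deriv_along X Y P + deriv_along X Y' P"
    if "smooth Y" "smooth Y'" for X Y Y' :: "'a vfield" and P
    unfolding deriv_along_def
    by (subst frechet_derivative_at[OF has_derivative_add[OF that[THEN smooth_has_derivative]],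
        symmetric]) simp
  have scale: "deriv_along X (\<lambda>P. f P *\<^sub>R Y P) P = deriv_along X f P *\<^sub>R Y P + f P *\<^sub>R deriv_along X Y P"
    if "smooth f" "smooth Y" for X Y :: "'a vfield" and f P
    unfolding deriv_along_def
    by (subst frechet_derivative_at[OF has_derivative_scaleR[OF that[THEN smooth_has_derivative]],
        symmetric]) simp
  show ?thesis
    unfolding affine_connection_def
  proof (intro conjI allI impI; (elim conjE)?)
    fix X Y :: "'a vfield"
    assume "smooth X" "smooth Y"
    then have "smooth (deriv_along X Y)" "smooth (\<lambda>P. \<Gamma> P (X P) (Y P))"
      by (auto intro: smooth_deriv_along smooth_bilinear_field bil sm)
    then show "smooth (christoffel_connection \<Gamma> X Y)"
      by (simp add: christoffel_connection_def smooth_add)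
  next
    fix X X' Y :: "'a vfield"
    assume "smooth X" "smooth X'" "smooth Y"
    then show "christoffel_connection \<Gamma> (\<lambda>P. X P + X' P) Y =
        (\<lambda>P. christoffel_connection \<Gamma> X Y P + christoffel_connection \<Gamma> X' Y P)"
      by (simp add: christoffel_connection_def smooth_add bilinear_ladd[OF bil] deriv_along_def
          linear_add[OF lin] add_ac)
  next
    fix X Y :: "'a vfield" and f :: "'a \<Rightarrow> real"
    assume "smooth X" "smooth Y" "smooth f"
    then show "christoffel_connection \<Gamma> (\<lambda>P. f P *\<^sub>R X P) Y =
        (\<lambda>P. f P *\<^sub>R christoffel_connection \<Gamma> X Y P)"
      by (simp add: christoffel_connection_def smooth_scaleR bilinear_lmul[OF bil] deriv_along_def
          linear_scale[OF lin] scaleR_add_right)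
  next
    fix X Y Y' :: "'a vfield"
    assume "smooth X" "smooth Y" "smooth Y'"
    then show "christoffel_connection \<Gamma> X (\<lambda>P. Y P + Y' P) =
        (\<lambda>P. christoffel_connection \<Gamma> X Y P + christoffel_connection \<Gamma> X Y' P)"
      by (simp add: christoffel_connection_def smooth_add bilinear_radd[OF bil] add add_ac)
  next
    fix X Y :: "'a vfield" and f :: "'a \<Rightarrow> real"
    assume "smooth X" "smooth Y" "smooth f"
    then show "christoffel_connection \<Gamma> X (\<lambda>P. f P *\<^sub>R Y P) =
        (\<lambda>P. deriv_along X f P *\<^sub>R Y P + f P *\<^sub>R christoffel_connection \<Gamma> X Y P)"
      by (simp add: christoffel_connection_def smooth_scaleR bilinear_rmul[OF bil] scale
          scaleR_add_right add_ac)
  qed (auto simp: christoffel_connection_def)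
qed

text \<open>
  Torsion-freeness amounts to symmetry of \<open>\<Gamma>\<close>. In the product rule for \<open>g(Y, Z)\<close>, the terms
  that differentiate \<open>Y\<close> and \<open>Z\<close> are those of \<open>\<partial>\<^sub>X Y\<close> and \<open>\<partial>\<^sub>X Z\<close>, so metric compatibility is left
  with the derivative of the coefficients of \<open>g\<close>, which is the last assumption.
\<close>

lemma levi_civita_eq_christoffel_connection:
  assumes g: "pseudo_riemannian_metric g"
    and bil: "\<And>P. bilinear (\<Gamma> P)" and sm: "\<And>v w. smooth (\<lambda>P. \<Gamma> P v w)"
    and sym: "\<And>P v w. \<Gamma> P v w = \<Gamma> P w v"
    and compat: "\<And>P u v w. frechet_derivative (\<lambda>Q. g Q v w) (at P) u =
      g P (\<Gamma> P u v) w + g P v (\<Gamma> P u w)"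
  shows "levi_civita g = christoffel_connection \<Gamma>"
proof -
  have g_bil: "\<And>P. bilinear (g P)" and g_sm: "\<And>v w. smooth (\<lambda>P. g P v w)"
    using g by (auto simp: pseudo_riemannian_metric_def)
  have affine: "affine_connection (christoffel_connection \<Gamma>)"
    by (rule affine_christoffel_connection[OF bil sm])
  have torsion: "torsion_free (christoffel_connection \<Gamma>)"
    by (auto simp: torsion_free_def christoffel_connection_def lie_bracket_def sym)
  have metric: "metric_connection g (christoffel_connection \<Gamma>)"
    unfolding metric_connection_def
  proof (intro allI impI ext, elim conjE)
    fix X Y Z :: "'a vfield" and P
    assume s: "smooth X" "smooth Y" "smooth Z"
    note der = has_derivative_bilinear_field[where B = g, OF g_bil smooth_differentiable[OF g_sm]
        smooth_has_derivative[OF s(2)] smooth_has_derivative[OF s(3)]]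
    show "deriv_along X (\<lambda>P. g P (Y P) (Z P)) P =
        g P (christoffel_connection \<Gamma> X Y P) (Z P) + g P (Y P) (christoffel_connection \<Gamma> X Z P)"
      using s
      by (simp add: christoffel_connection_def deriv_along_def frechet_derivative_at[OF der, symmetric]
          compat bilinear_ladd[OF g_bil] bilinear_radd[OF g_bil])
  qed
  show ?thesis
    unfolding levi_civita_def
  proof (rule the_equality)
    show "D = christoffel_connection \<Gamma>"
      if "affine_connection D \<and> torsion_free D \<and> metric_connection g D" for D
      using that by (intro metric_torsion_free_connection_unique[OF g _ _ _ affine torsion metric]) auto
  qed (intro conjI affine torsion metric)
qed

lemma curvature_christoffel_connection_const:
  assumes sm: "\<And>v w. smooth (\<lambda>P. \<Gamma> P v w)" and zero: "\<And>P w. \<Gamma> P 0 w = 0"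
  shows "curvature (christoffel_connection \<Gamma>) (\<lambda>Q. x) (\<lambda>Q. y) (\<lambda>Q. z) P =
    frechet_derivative (\<lambda>Q. \<Gamma> Q y z) (at P) x + \<Gamma> P x (\<Gamma> P y z) -
    (frechet_derivative (\<lambda>Q. \<Gamma> Q x z) (at P) y + \<Gamma> P y (\<Gamma> P x z))"
  by (simp add: curvature_def christoffel_connection_def deriv_along_def lie_bracket_def sm zero
      frechet_derivative_const)

text \<open>
  Here \<open>\<Gamma>\<close> has values in the kernel of \<open>\<pi>\<close> and kills that kernel. The quadratic terms
  \<open>\<Gamma>(x, \<Gamma>(y, z))\<close> of the curvature then vanish. The remaining terms \<open>\<partial>\<^sub>x \<Gamma>(y, z)\<close> stay in the kernel,
  because the same kernel serves at every point, and they vanish for \<open>z\<close> in the kernel.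
\<close>

lemma curvature_vertical:
  assumes sm: "\<And>v w. smooth (\<lambda>P. \<Gamma> P v w)" and zero: "\<And>P w. \<Gamma> P 0 w = 0"
    and \<pi>: "bounded_linear \<pi>"
    and range: "\<And>P v w. \<pi> (\<Gamma> P v w) = 0" and kills: "\<And>P v w. \<pi> w = 0 \<Longrightarrow> \<Gamma> P v w = 0"
  shows "\<pi> (curvature (christoffel_connection \<Gamma>) (\<lambda>Q. x) (\<lambda>Q. y) (\<lambda>Q. z) P) = 0"
    and "\<pi> z = 0 \<Longrightarrow> curvature (christoffel_connection \<Gamma>) (\<lambda>Q. x) (\<lambda>Q. y) (\<lambda>Q. z) P = 0"
proof -
  have "\<pi> (frechet_derivative (\<lambda>Q. \<Gamma> Q v w) (at P) u) = 0" for u v w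
  proof -
    have "((\<lambda>Q. \<pi> (\<Gamma> Q v w)) has_derivative
        (\<lambda>u. \<pi> (frechet_derivative (\<lambda>Q. \<Gamma> Q v w) (at P) u))) (at P)"
      by (rule bounded_linear.has_derivative[OF \<pi> smooth_has_derivative[OF sm]])
    moreover have "((\<lambda>Q. \<pi> (\<Gamma> Q v w)) has_derivative (\<lambda>u. 0)) (at P)"
      by (simp add: range)
    ultimately show ?thesis
      by (metis has_derivative_unique)
  qed
  then show "\<pi> (curvature (christoffel_connection \<Gamma>) (\<lambda>Q. x) (\<lambda>Q. y) (\<lambda>Q. z) P) = 0"
    using \<pi> by (simp add: curvature_christoffel_connection_const[where \<Gamma> = \<Gamma>, OF sm zero] kills range
        linear_diff bounded_linear.linear)
  show "curvature (christoffel_connection \<Gamma>) (\<lambda>Q. x) (\<lambda>Q. y) (\<lambda>Q. z) P = 0" if "\<pi> z = 0"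
    using that by (simp add: curvature_christoffel_connection_const[where \<Gamma> = \<Gamma>, OF sm zero] kills range
        frechet_derivative_const linear_0[OF bounded_linear.linear[OF \<pi>]])
qed


section \<open>Orthonormal frames\<close>

text \<open>
  Pairing a vanishing linear combination with a frame vector isolates its coefficient, since no frame
  vector is null; this makes the frame independent, and the dimension makes it spanning.
\<close>

lemma has_signature_orthonormal_frame:
  fixes f :: "'s::finite \<Rightarrow> 'a::euclidean_space" and \<epsilon> :: "'s \<Rightarrow> real"
  assumes b: "bilinear b"
    and frame: "\<And>s t. b (f s) (f t) = (if s = t then \<epsilon> s else 0)"
    and sign: "\<And>s. \<epsilon> s = -1 \<or> \<epsilon> s = 1"
    and dim: "CARD('s) = DIM('a)"
  shows "has_signature b (card {s. \<epsilon> s = -1}) (card {s. \<epsilon> s = 1})"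
proof -
  interpret l: linear "\<lambda>v. b v w" for w
    using b by (simp add: bilinear_def)
  have ne: "\<epsilon> s \<noteq> 0" for s
    using sign[of s] by auto
  have inj: "inj f"
    by (rule injI) (metis frame ne)
  have ind: "independent (range f)"
    unfolding independent_explicit_module
  proof (intro allI impI)
    fix T :: "'a set" and c v
    assume T: "finite T" "T \<subseteq> range f" and sum0: "(\<Sum>v\<in>T. c v *\<^sub>R v) = 0" and v: "v \<in> T"
    obtain s where s: "v = f s"
      using T v by auto
    have "0 = b (\<Sum>v\<in>T. c v *\<^sub>R v) v"
      by (simp add: sum0 bilinear_lzero[OF b])
    also have "\<dots> = (\<Sum>w\<in>T. c w * b w v)"
      by (simp add: l.sum l.scale)
    also have "\<dots> = (\<Sum>w\<in>T. if w = v then c v * \<epsilon> s else 0)"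
    proof (rule sum.cong[OF refl])
      fix w
      assume "w \<in> T"
      then obtain t where "w = f t"
        using T(2) by auto
      then show "c w * b w v = (if w = v then c v * \<epsilon> s else 0)"
        using injD[OF inj, of t s] by (auto simp: s frame)
    qed
    also have "\<dots> = c v * \<epsilon> s"
      using T(1) v by simp
    finally show "c v = 0"
      using ne by simp
  qed
  have "card (range f) = DIM('a)"
    using inj dim by (simp add: card_image)
  then have span: "span (range f) = UNIV"
    using card_ge_dim_independent[OF subset_UNIV ind] by auto
  have "card {v \<in> range f. b v v = c} = card {s. \<epsilon> s = c}" for c
  proof -
    have "{v \<in> range f. b v v = c} = f ` {s. \<epsilon> s = c}"
      by (auto simp: frame)
    then show ?thesis
      using inj by (simp add: card_image inj_on_subset)
  qed
  then show ?thesis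
    unfolding has_signature_def using ind span sign
    by (intro exI[of _ "range f"]) (auto simp: frame)
qed


section \<open>Non-degeneracy and signature of the metric\<close>

lemma sum_UNIV_sum:
  fixes f :: "'a::finite + 'b::finite \<Rightarrow> 'c::comm_monoid_add"
  shows "(\<Sum>s\<in>UNIV. f s) = (\<Sum>i\<in>UNIV. f (Inl i)) + (\<Sum>i\<in>UNIV. f (Inr i))"
  by (simp add: UNIV_Plus_UNIV[symmetric] sum.Plus del: UNIV_Plus_UNIV)

lemma g_psi_blocks:
  "g_psi \<psi> P v w =
    (\<Sum>i\<in>UNIV. \<Sum>j\<in>UNIV. \<psi> i j (x_part P) * v $ Inl i * w $ Inl j) +
    (\<Sum>i\<in>UNIV. v $ Inl i * w $ Inr i + v $ Inr i * w $ Inl i)"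
  unfolding g_psi_def
  by (simp add: sum_UNIV_sum sum.distrib if_distrib[of "\<lambda>x. x * _"] cong: if_cong)

lemma g_psi_y_axis: "g_psi \<psi> P v (axis (Inr i) 1) = v $ Inl i"
  by (simp add: g_psi_blocks axis_def if_distrib[of "\<lambda>x. _ * x"] cong: if_cong)

lemma g_psi_x_axis:
  "g_psi \<psi> P v (axis (Inl i) 1) = (\<Sum>j\<in>UNIV. \<psi> j i (x_part P) * v $ Inl j) + v $ Inr i"
  by (simp add: g_psi_blocks axis_def if_distrib[of "\<lambda>x. _ * x"] cong: if_cong)

lemma bounded_linear_x_part: "bounded_linear x_part"
  unfolding x_part_def
  by (intro linear_conv_bounded_linear[THEN iffD1]) (auto intro!: linearI simp: vec_eq_iff)

lemma bilinear_g_psi: "bilinear (g_psi \<psi> P)"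
  unfolding bilinear_def g_psi_def
  by (auto intro!: linearI simp: algebra_simps sum.distrib sum_distrib_left)

lemma smooth_g_psi:
  assumes "\<And>i j. smooth (\<psi> i j)"
  shows "smooth (\<lambda>P. g_psi \<psi> P v w)"
proof -
  have "smooth (\<lambda>P. g_psi_component \<psi> P a b)" for a b
    by (cases a; cases b) (simp_all add: smooth_compose_linear[OF bounded_linear_x_part assms])
  then show ?thesis
    unfolding g_psi_def by (intro smooth_sum smooth_mult smooth_const)
qed

lemma g_psi_sym:
  assumes sym: "\<And>i j x. \<psi> i j x = \<psi> j i x"
  shows "g_psi \<psi> P v w = g_psi \<psi> P w v"
  unfolding g_psi_blocks
  by (subst (2) sum.swap) (auto simp: algebra_simps sym intro!: sum.cong arg_cong2[where f = "(+)"])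

lemma pseudo_riemannian_g_psi:
  assumes "\<And>i j. smooth (\<psi> i j)" and sym: "\<And>i j x. \<psi> i j x = \<psi> j i x"
  shows "pseudo_riemannian_metric (g_psi \<psi>)"
proof -
  have "v = 0" if "\<forall>w. g_psi \<psi> P v w = 0" for P v
  proof -
    have x: "v $ Inl i = 0" for i
      using that by (metis g_psi_y_axis)
    have "v $ Inr i = 0" for i
      using that[rule_format, of "axis (Inl i) 1"] by (simp add: g_psi_x_axis x)
    with x show ?thesis
      by (metis vec_eq_iff sum.exhaust zero_index)
  qed
  then show ?thesis
    unfolding pseudo_riemannian_metric_def
    using bilinear_g_psi smooth_g_psi[of \<psi>, OF assms(1)] g_psi_sym[of \<psi>, OF sym] by blast
qed

text \<open>
  In the frame \<open>u\<^sub>i \<plusminus> 1/2 \<partial>\<^sub>y\<^sub>i\<close> with \<open>u\<^sub>i = \<partial>\<^sub>x\<^sub>i - 1/2 \<Sum>\<^sub>j \<psi>\<^sub>i\<^sub>j \<partial>\<^sub>y\<^sub>j\<close>, the two halves of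
  \<open>\<psi>\<close> cancel \<open>g(\<partial>\<^sub>x\<^sub>i, \<partial>\<^sub>x\<^sub>j)\<close>, and what is left pairs \<open>\<partial>\<^sub>x\<^sub>i\<close> with \<open>\<plusminus> 1/2 \<partial>\<^sub>y\<^sub>i\<close>.
\<close>

lemma has_signature_g_psi:
  fixes \<psi> :: "'p::finite \<Rightarrow> 'p \<Rightarrow> real ^ 'p \<Rightarrow> real"
  assumes sym: "\<And>i j x. \<psi> i j x = \<psi> j i x"
  shows "has_signature (g_psi \<psi> P) CARD('p) CARD('p)"
proof -
  \<comment> \<open>The frame is indexed by the coordinates: \<open>Inl i\<close> gives the vector with sign \<open>-\<close>, \<open>Inr i\<close> the one with \<open>+\<close>.\<close>
  define \<epsilon> :: "'p + 'p \<Rightarrow> real" where "\<epsilon> = case_sum (\<lambda>i. -1) (\<lambda>i. 1)"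
  define \<nu> :: "'p + 'p \<Rightarrow> 'p" where "\<nu> = case_sum id id"
  define f :: "'p + 'p \<Rightarrow> real ^ ('p + 'p)" where
    "f s = (\<chi> a. case a of Inl j \<Rightarrow> (if \<nu> s = j then 1 else 0)
      | Inr j \<Rightarrow> (if \<nu> s = j then \<epsilon> s / 2 else 0) - \<psi> (\<nu> s) j (x_part P) / 2)" for s
  have "g_psi \<psi> P (f s) (f t) = (if \<nu> s = \<nu> t then (\<epsilon> s + \<epsilon> t) / 2 else 0)" for s t
    unfolding g_psi_blocks f_def
    by (simp add: if_distrib[of "\<lambda>x. _ * x"] if_distrib[of "\<lambda>x. x * _"] sum.distrib
        cong: if_cong) (auto simp: sym[of "\<nu> t" "\<nu> s"] field_simps)
  then have "g_psi \<psi> P (f s) (f t) = (if s = t then \<epsilon> s else 0)" for s t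
    by (cases s; cases t) (auto simp: \<epsilon>_def \<nu>_def)
  then have "has_signature (g_psi \<psi> P) (card {s. \<epsilon> s = -1}) (card {s. \<epsilon> s = 1})"
    by (rule has_signature_orthonormal_frame[OF bilinear_g_psi]) (auto simp: \<epsilon>_def split: sum.splits)
  moreover have "{s. \<epsilon> s = -1} = range Inl" "{s. \<epsilon> s = 1} = range Inr"
    by (auto simp: \<epsilon>_def image_iff split: sum.splits) (metis sum.exhaust)+
  ultimately show ?thesis
    by (simp add: card_image)
qed


section \<open>The Christoffel symbols and the curvature of the metric\<close>

definition g_psi_derivative ::
  "('p::finite \<Rightarrow> 'p \<Rightarrow> real ^ 'p \<Rightarrow> real) \<Rightarrow> real ^ ('p + 'p) \<Rightarrow>
    real ^ ('p + 'p) \<Rightarrow> real ^ ('p + 'p) \<Rightarrow> real ^ ('p + 'p) \<Rightarrow> real" where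
  "g_psi_derivative \<psi> P u v w = frechet_derivative (\<lambda>Q. g_psi \<psi> Q v w) (at P) u"

text \<open>
  The coefficients are the Christoffel symbols of the first kind with last index \<open>x\<^sub>k\<close>. Those with last
  index \<open>y\<^sub>k\<close> vanish, and pairing with \<open>\<partial>\<^sub>y\<^sub>k\<close> reads off the \<open>x\<^sub>k\<close>-component, so raising the index
  takes no inverse of the metric beyond replacing \<open>\<partial>\<^sub>x\<^sub>k\<close> by \<open>\<partial>\<^sub>y\<^sub>k\<close>.
\<close>

definition christoffel_psi ::
  "('p::finite \<Rightarrow> 'p \<Rightarrow> real ^ 'p \<Rightarrow> real) \<Rightarrow> real ^ ('p + 'p) \<Rightarrow>
    real ^ ('p + 'p) \<Rightarrow> real ^ ('p + 'p) \<Rightarrow> real ^ ('p + 'p)" where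
  "christoffel_psi \<psi> P u v =
    (\<Sum>k\<in>UNIV. ((g_psi_derivative \<psi> P u v (axis (Inl k) 1) + g_psi_derivative \<psi> P v u (axis (Inl k) 1)
      - g_psi_derivative \<psi> P (axis (Inl k) 1) u v) / 2) *\<^sub>R axis (Inr k) 1)"

context
  fixes \<psi> :: "'p::finite \<Rightarrow> 'p \<Rightarrow> real ^ 'p \<Rightarrow> real"
  assumes smooth_psi: "\<And>i j. smooth (\<psi> i j)"
    and sym_psi: "\<And>i j x. \<psi> i j x = \<psi> j i x"
begin

lemma bilinear_g_psi_derivative: "bilinear (g_psi_derivative \<psi> P u)"
  unfolding g_psi_derivative_def
  by (rule bilinear_derivative[where B = "g_psi \<psi>", OF bilinear_g_psi
        smooth_differentiable[OF smooth_g_psi[OF smooth_psi]]])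

lemma linear_g_psi_derivative: "linear (\<lambda>u. g_psi_derivative \<psi> P u v w)"
  unfolding g_psi_derivative_def
  by (rule linear_frechet_derivative[OF smooth_differentiable[OF smooth_g_psi[OF smooth_psi]]])

lemma g_psi_derivative_sym: "g_psi_derivative \<psi> P u v w = g_psi_derivative \<psi> P u w v"
  unfolding g_psi_derivative_def by (subst g_psi_sym[of \<psi>, OF sym_psi]) (rule refl)

text \<open>
  Pairing with a vertical vector does not involve \<open>\<psi>\<close>, so it is constant along the manifold.
\<close>

lemma g_psi_derivative_vertical_argument:
  assumes "x_part w = 0"
  shows "g_psi_derivative \<psi> P u v w = 0"
proof -
  have "w $ Inl i = 0" for i
    using assms by (simp add: x_part_def vec_eq_iff)
  then have "(\<lambda>Q. g_psi \<psi> Q v w) = (\<lambda>Q. \<Sum>i\<in>UNIV. v $ Inl i * w $ Inr i)"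
    by (simp add: g_psi_blocks)
  then show ?thesis
    by (simp add: g_psi_derivative_def frechet_derivative_const)
qed

lemma g_psi_derivative_vertical_argument':
  "x_part v = 0 \<Longrightarrow> g_psi_derivative \<psi> P u v w = 0"
  using g_psi_derivative_vertical_argument by (subst g_psi_derivative_sym)

text \<open>
  The coefficients of the metric are functions of \<open>x\<close> alone.
\<close>

lemma g_psi_derivative_vertical_direction:
  assumes "x_part u = 0"
  shows "g_psi_derivative \<psi> P u v w = 0"
proof -
  define G where "G q = (\<Sum>i\<in>UNIV. \<Sum>j\<in>UNIV. \<psi> i j q * v $ Inl i * w $ Inl j) +
    (\<Sum>i\<in>UNIV. v $ Inl i * w $ Inr i + v $ Inr i * w $ Inl i)" for q
  have "smooth G"
    unfolding G_def by (intro smooth_add smooth_sum smooth_mult smooth_const smooth_psi)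
  then have G: "G differentiable (at (x_part P))"
    by (rule smooth_differentiable)
  have "g_psi_derivative \<psi> P u v w = frechet_derivative (\<lambda>Q. G (x_part Q)) (at P) u"
    by (simp add: g_psi_derivative_def g_psi_blocks G_def)
  also have "\<dots> = frechet_derivative G (at (x_part P)) (x_part u)"
    by (simp add: frechet_derivative_at[OF
          frechet_derivative_compose_linear[OF bounded_linear_x_part G], symmetric])
  also have "\<dots> = 0"
    by (simp add: assms linear_0[OF linear_frechet_derivative[OF G]])
  finally show ?thesis .
qed

lemma x_part_christoffel: "x_part (christoffel_psi \<psi> P u v) = 0"
  by (simp add: x_part_def christoffel_psi_def vec_eq_iff axis_def)

lemma christoffel_vertical: "x_part v = 0 \<Longrightarrow> christoffel_psi \<psi> P u v = 0"
  by (simp add: christoffel_psi_def g_psi_derivative_vertical_argument g_psi_derivative_vertical_argument'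
      g_psi_derivative_vertical_direction)

lemma christoffel_sym: "christoffel_psi \<psi> P u v = christoffel_psi \<psi> P v u"
  by (simp add: christoffel_psi_def g_psi_derivative_sym[of P _ u v] algebra_simps)

lemma bilinear_christoffel: "bilinear (christoffel_psi \<psi> P)"
proof -
  note simps = bilinear_ladd[OF bilinear_g_psi_derivative] bilinear_radd[OF bilinear_g_psi_derivative]
    bilinear_lmul[OF bilinear_g_psi_derivative] bilinear_rmul[OF bilinear_g_psi_derivative]
    linear_add[OF linear_g_psi_derivative] linear_scale[OF linear_g_psi_derivative]
  show ?thesis
    unfolding bilinear_def christoffel_psi_def
    by (auto intro!: linearI sum.cong
        simp: simps sum.distrib[symmetric] scaleR_sum_right scaleR_left_distrib[symmetric] field_simps)
qed

lemma smooth_christoffel: "smooth (\<lambda>P. christoffel_psi \<psi> P u v)"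
  unfolding christoffel_psi_def g_psi_derivative_def divide_inverse
  by (intro smooth_sum smooth_scaleR smooth_mult smooth_add smooth_minus smooth_const
      smooth_directional_derivative smooth_g_psi smooth_psi)

text \<open>
  Both sides depend on \<open>w\<close> only through its \<open>x\<close>-part: the left one because \<open>\<Gamma>\<close> is vertical,
  the right one by the two vanishing properties of the derivatives.
\<close>

lemma koszul:
  "g_psi \<psi> P (christoffel_psi \<psi> P u v) w =
    (g_psi_derivative \<psi> P u v w + g_psi_derivative \<psi> P v u w - g_psi_derivative \<psi> P w u v) / 2"
proof -
  define h where "h = (\<Sum>k\<in>UNIV. w $ Inl k *\<^sub>R axis (Inl k) (1::real) :: real ^ ('p + 'p))"
  have vert: "x_part (w - h) = 0"
    by (simp add: x_part_def h_def vec_eq_iff axis_def if_distrib[of "\<lambda>x. _ * x"] cong: if_cong)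
  interpret l: linear "\<lambda>u. g_psi_derivative \<psi> P u a b" for a b
    by (rule linear_g_psi_derivative)
  interpret r: linear "g_psi_derivative \<psi> P a b" for a b
    using bilinear_g_psi_derivative[of P a] by (simp add: bilinear_def)
  interpret g: linear "\<lambda>v. g_psi \<psi> P v w"
    using bilinear_g_psi[of \<psi> P] by (simp add: bilinear_def)
  have argument: "g_psi_derivative \<psi> P a b w = (\<Sum>k\<in>UNIV. w $ Inl k * g_psi_derivative \<psi> P a b (axis (Inl k) 1))"
    for a b
  proof -
    have "g_psi_derivative \<psi> P a b w = g_psi_derivative \<psi> P a b h"
      using g_psi_derivative_vertical_argument[OF vert, of P a b] by (simp add: r.diff)
    then show ?thesis
      by (simp add: h_def r.sum r.scale)
  qed
  have direction: "g_psi_derivative \<psi> P w a b = (\<Sum>k\<in>UNIV. w $ Inl k * g_psi_derivative \<psi> P (axis (Inl k) 1) a b)"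
    for a b
  proof -
    have "g_psi_derivative \<psi> P w a b = g_psi_derivative \<psi> P h a b"
      using g_psi_derivative_vertical_direction[OF vert, of P a b] by (simp add: l.diff)
    then show ?thesis
      by (simp add: h_def l.sum l.scale)
  qed
  have vertical: "g_psi \<psi> P (axis (Inr k) 1) w = w $ Inl k" for k
    by (subst g_psi_sym[of \<psi>, OF sym_psi]) (rule g_psi_y_axis)
  have "g_psi \<psi> P (christoffel_psi \<psi> P u v) w =
      (\<Sum>k\<in>UNIV. (w $ Inl k * g_psi_derivative \<psi> P u v (axis (Inl k) 1) +
        w $ Inl k * g_psi_derivative \<psi> P v u (axis (Inl k) 1) -
        w $ Inl k * g_psi_derivative \<psi> P (axis (Inl k) 1) u v) / 2)"
    by (simp add: christoffel_psi_def g.sum g.scale vertical field_simps)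
  then show ?thesis
    by (simp only: argument direction sum.distrib sum_subtractf sum_divide_distrib[symmetric])
qed

lemma levi_civita_g_psi: "levi_civita (g_psi \<psi>) = christoffel_connection (christoffel_psi \<psi>)"
proof (rule levi_civita_eq_christoffel_connection)
  fix P u v w
  have "g_psi \<psi> P v (christoffel_psi \<psi> P u w) = g_psi \<psi> P (christoffel_psi \<psi> P u w) v"
    by (rule g_psi_sym[of \<psi>, OF sym_psi])
  then show "frechet_derivative (\<lambda>Q. g_psi \<psi> Q v w) (at P) u =
      g_psi \<psi> P (christoffel_psi \<psi> P u v) w + g_psi \<psi> P v (christoffel_psi \<psi> P u w)"
    using g_psi_derivative_sym[of P u v w] g_psi_derivative_sym[of P v u w] g_psi_derivative_sym[of P w u v]
    by (simp add: koszul g_psi_derivative_def field_simps)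
qed (use pseudo_riemannian_g_psi[OF smooth_psi sym_psi] bilinear_christoffel smooth_christoffel
    christoffel_sym in auto)

text \<open>
  The inner operator produces a vertical vector, and the outer one kills it.
\<close>

lemma curvature_operator_comp:
  "curvature_operator (g_psi \<psi>) P x y (curvature_operator (g_psi \<psi>) P x' y' z) = 0"
  unfolding curvature_operator_def levi_civita_g_psi
  by (intro curvature_vertical[where \<pi> = x_part] smooth_christoffel bounded_linear_x_part
      x_part_christoffel christoffel_vertical bilinear_lzero[OF bilinear_christoffel])

end

theorem theorem5p1:
  fixes \<psi> :: "'p::finite \<Rightarrow> 'p \<Rightarrow> real ^ 'p \<Rightarrow> real"
  assumes "\<And>i j. smooth (\<psi> i j)"
    and "\<And>i j x. \<psi> i j x = \<psi> j i x"
  shows "pseudo_riemannian_metric (g_psi \<psi>) \<and>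
    (\<forall>P. has_signature (g_psi \<psi> P) CARD('p) CARD('p)) \<and>
    skew_tsankov (g_psi \<psi>) \<and>
    curvature_nilpotent (g_psi \<psi>) 2"
proof (intro conjI allI)
  note RR = curvature_operator_comp[of \<psi>, OF assms]
  show "pseudo_riemannian_metric (g_psi \<psi>)"
    by (rule pseudo_riemannian_g_psi[OF assms])
  show "has_signature (g_psi \<psi> P) CARD('p) CARD('p)" for P
    by (rule has_signature_g_psi[OF assms(2)])
  show "skew_tsankov (g_psi \<psi>)"
    by (auto simp: skew_tsankov_def fun_eq_iff RR)
  show "curvature_nilpotent (g_psi \<psi>) 2"
    by (auto simp: curvature_nilpotent_def fun_eq_iff RR numeral_2_eq_2)
qed

end
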